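(* Let $T$ be a rooted tree of size $s$ with a distinguished subset of vertices $V_D$ and let $n \ge s$ be an integer. For every $v \in V_D$, $$ d(T;n) = \binom{n}{h_v}\cdot d\big(T^{\uparrow v}_v; h_v\big)\cdot d\big(T\setminus T_v; n-h_v\big) - d\big(T^{\uparrow v}; n\big), $$ where, by convention, $d(\emptyset;k)=1$ for $k\ge 0$.
   Context: Rooted trees are finite and nonempty (except where the empty tree $\emptyset$ is mentioned). $T$ has vertex set $V$ of size $s$; $p(v)$ is the parent of a non-root vertex $v$. $T$ comes with a distinguished subset $V_D\subseteq V$, whose elements are called descent vertices; all other vertices are ascent vertices. For an integer $n\ge s$, $G(T;n)$ is the rooted tree with $n$ vertices obtained by adding a chain of $n-s$ vertices above the root of $T$ (if $n>s$, the root of $T$ becomes the child of the bottom vertex of the chain and the top of the chain is the root of $G(T;n)$); the added vertices are ascent vertices. A labeling of a rooted tree with $m$ vertices is a bijection $w$ from its vertices to $[m]=\{1,\dots,m\}$, and $\mathrm{Des}(w)$ is the set of non-root vertices $v$ with $w(v)>w(p(v))$. $D(T;n)$ is the set of labelings $w$ of $G(T;n)$ with $\mathrm{Des}(w)=V_D$, and $d(T;n)=|D(T;n)|$. $T_v$ is the subtree of $T$ rooted at $v$ (consisting of $v$ and all its descendants), $h_v$ is its number of vertices, and $T\setminus T_v$ is the tree obtained from $T$ by deleting $T_v$ (empty if $v$ is the root). For $v\in V_D$, $T^{\uparrow v}$ is $T$ with $v$ changed from a descent vertex to an ascent vertex (i.e. with distinguished set $V_D\setminus\{v\}$), and $T^{\uparrow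 v}_v$ is the subtree of $T^{\uparrow v}$ rooted at $v$. All these trees inherit their distinguished descent vertices from the tree they are derived from, and $d$ of such a tree is computed with the inherited set. *)

theory Defs
  imports Main "HOL-Library.FuncSet"
begin

text \<open>
  The root is the vertex without a parent. The record also covers the empty tree
  (no vertices), which arises when the whole tree is deleted.
\<close>

record 'a dtree =
  verts :: "'a set"
  parent :: "'a \<rightharpoonup> 'a"
  descs :: "'a set"

definition parent_rel :: "'a dtree \<Rightarrow> ('a \<times> 'a) set" where
  "parent_rel T = {(u, q). parent T u = Some q}"

definition rooted_tree :: "'a dtree \<Rightarrow> bool" where
  "rooted_tree T \<longleftrightarrow>
     finite (verts T) \<and> descs T \<subseteq> verts T \<and> ran (parent T) \<subseteq> verts T \<and>
     (\<exists>r \<in> verts T. dom (parent T) = verts T - {r} \<and>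
        (\<forall>u \<in> verts T. (u, r) \<in> (parent_rel T)\<^sup>*))"

text \<open>The descendants of a vertex include the vertex itself.\<close>

definition descendants :: "'a dtree \<Rightarrow> 'a \<Rightarrow> 'a set" where
  "descendants T v = {u \<in> verts T. (u, v) \<in> (parent_rel T)\<^sup>*}"

definition subtree :: "'a dtree \<Rightarrow> 'a \<Rightarrow> 'a dtree" where
  "subtree T v =
     \<lparr>verts = descendants T v,
      parent = (parent T |` descendants T v)(v := None),
      descs = descs T \<inter> descendants T v\<rparr>"

definition hook :: "'a dtree \<Rightarrow> 'a \<Rightarrow> nat" where
  "hook T v = card (verts (subtree T v))"

definition delete_subtree :: "'a dtree \<Rightarrow> 'a \<Rightarrow> 'a dtree" where
  "delete_subtree T v =
     \<lparr>verts = verts T - descendants T v,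
      parent = parent T |` (verts T - descendants T v),
      descs = descs T - descendants T v\<rparr>"

definition make_ascent :: "'a dtree \<Rightarrow> 'a \<Rightarrow> 'a dtree" where
  "make_ascent T v = T\<lparr>descs := descs T - {v}\<rparr>"

text \<open>
  The tree \<open>G(T;n)\<close>: the old vertices are \<open>Inl u\<close>, the chain vertices are \<open>Inr i\<close> with
  \<open>i < n - card (verts T)\<close>, where \<open>Inr 0\<close> is the bottom of the chain.
\<close>

definition chain_ext :: "'a dtree \<Rightarrow> nat \<Rightarrow> ('a + nat) dtree" where
  "chain_ext T n =
     \<lparr>verts = Inl ` verts T \<union> Inr ` {..<n - card (verts T)},
      parent = (\<lambda>x. case x of
          Inl u \<Rightarrow> (case parent T u of
              Some q \<Rightarrow> Some (Inl q)
            | None \<Rightarrow> if u \<in> verts T \<and> card (verts T) < n then Some (Inr 0) else None)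
        | Inr i \<Rightarrow> if i + 1 < n - card (verts T) then Some (Inr (i + 1)) else None),
      descs = Inl ` descs T\<rparr>"

text \<open>Labelings are taken to be \<open>undefined\<close> off the vertex set, so that they can be counted.\<close>

definition labelings :: "'a dtree \<Rightarrow> ('a \<Rightarrow> nat) set" where
  "labelings T = {w \<in> extensional (verts T). bij_betw w (verts T) {1..card (verts T)}}"

definition Des :: "'a dtree \<Rightarrow> ('a \<Rightarrow> nat) \<Rightarrow> 'a set" where
  "Des T w = {v \<in> verts T. \<exists>q. parent T v = Some q \<and> w v > w q}"

definition D_set :: "'a dtree \<Rightarrow> nat \<Rightarrow> ('a + nat \<Rightarrow> nat) set" where
  "D_set T n = {w \<in> labelings (chain_ext T n). Des (chain_ext T n) w = Inl ` descs T}"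

text \<open>The case distinction is the convention for the empty tree.\<close>

definition d :: "'a dtree \<Rightarrow> nat \<Rightarrow> nat" where
  "d T n = (if verts T = {} then 1 else card (D_set T n))"

end

theory Submission
  imports Defs "HOL-Library.Infinite_Set"
begin

text \<open>
  Moving the subtracted term to the other side, the claim is that \<open>d(T;n) + d(T\<^sup>\<up>\<^sup>v;n)\<close> equals the
  product. The left-hand side counts the labelings of \<open>G(T;n)\<close> in which every vertex other than
  \<open>v\<close> is a descent exactly if it is prescribed to be one, while the edge above \<open>v\<close> is free to go
  either way. Cutting that free edge therefore loses no constraint: such a labeling consists of
  the set of labels used in the subtree at \<open>v\<close>, which is any subset of the \<open>n\<close> labels of size \<open>h\<^sub>v\<close>, and of
  two independent labelings, one of the subtree at \<open>v\<close> with that label set, and one of the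
  remaining tree with the complementary labels (\<open>bij_betw_split\<close>).

  Only the relative order of labels matters for descents, so the number of labelings of a
  component depends only on how many labels there are, not on which
  (\<open>card_des_labelings_eq\<close>). This makes all terms of the resulting sum over label sets equal, and
  \<open>n choose h\<^sub>v\<close> is their number (\<open>card_des_labelings_cut\<close>).

  The argument is carried out directly on the extended tree, whose chain is just more vertices.
  It then remains to see that extending by a chain commutes with cutting: the chain stays with the
  part that contains the root. If \<open>v\<close> is itself the root, that part is the bare chain. A chain
  has a unique labeling without descents, which is why the convention \<open>d(\<emptyset>;k) = 1\<close> agrees
  with the general definition (\<open>d_eq_card_D_set\<close>) and the root needs no case of its own.
\<close>

section \<open>Labelings with an arbitrary label set\<close>

text \<open>
  After the cut the two parts share out the labels, so their label sets are no longer initial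
  segments. Descent conditions still make sense for any set of labels.
\<close>

definition des_labelings :: "'a dtree \<Rightarrow> nat set \<Rightarrow> ('a \<Rightarrow> nat) set" where
  "des_labelings G L =
     {w \<in> extensional (verts G). bij_betw w (verts G) L \<and> Des G w = descs G}"

lemma finite_des_labelings:
  assumes "finite (verts G)" "finite L"
  shows "finite (des_labelings G L)"
proof (rule finite_subset)
  show "des_labelings G L \<subseteq> (verts G \<rightarrow>\<^sub>E L)"
    unfolding des_labelings_def by (auto simp: PiE_def bij_betw_def)
  show "finite (verts G \<rightarrow>\<^sub>E L)"
    using assms by (simp add: finite_PiE)
qed

text \<open>
  Composition with the order isomorphism between two label sets preserves descents. One inequality
  is enough, since the situation is symmetric. The hypothesis on parents ensures that each
  comparison is between two labels in \<open>L\<close>.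
\<close>

lemma card_des_labelings_le:
  assumes "finite (verts G)" and closed: "ran (parent G) \<subseteq> verts G"
    and "finite L" "finite L'" "card L = card L'"
  shows "card (des_labelings G L) \<le> card (des_labelings G L')"
proof -
  \<comment> \<open>\<open>f\<close> maps the element of \<open>L\<close> of a given rank to the element of \<open>L'\<close> of the same rank.\<close>
  define f where "f x = enumerate L' (card {y \<in> L. y < x})" for x
  have rank_bound: "card {y \<in> L. y < x} < card L'" if "x \<in> L" for x
    using that assms(3,5) psubset_card_mono[of L "{y \<in> L. y < x}"] by auto
  have mono: "f x < f y \<longleftrightarrow> x < y" if "x \<in> L" "y \<in> L" for x y
  proof -
    have lt: "f a < f b" if "a \<in> L" "b \<in> L" "a < b" for a b
    proof -
      have "{z \<in> L. z < a} \<subset> {z \<in> L. z < b}" using that by auto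
      then have "card {z \<in> L. z < a} < card {z \<in> L. z < b}"
        using assms(3) by (simp add: psubset_card_mono)
      then show ?thesis
        unfolding f_def using finite_enumerate_mono[of _ _ L'] assms(4) rank_bound[OF that(2)] by blast
    qed
    show ?thesis using lt[of x y] lt[of y x] that by (metis less_asym linorder_neqE_nat less_irrefl)
  qed
  have inj: "inj_on f L"
    using mono by (metis inj_onI linorder_neqE_nat less_irrefl)
  have "f ` L \<subseteq> L'"
    unfolding f_def using rank_bound assms(4) by (auto intro: finite_enumerate_in_set)
  then have bij: "bij_betw f L L'"
    using inj assms(4,5) by (metis bij_betw_def card_image card_subset_eq)
  let ?F = "\<lambda>w. restrict (f \<circ> w) (verts G)"
  have "?F w \<in> des_labelings G L'" if "w \<in> des_labelings G L" for w
  proof -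
    have w: "bij_betw w (verts G) L" "Des G w = descs G"
      using that by (auto simp: des_labelings_def)
    have "bij_betw (?F w) (verts G) L'"
      using bij_betw_trans[OF w(1) bij] by (simp cong: bij_betw_cong)
    moreover have "Des G (?F w) = Des G w"
    proof -
      have "q \<in> verts G" if "parent G u = Some q" for u q
        using closed that by (auto intro: ranI)
      then have "f (w u) > f (w q) \<longleftrightarrow> w u > w q" if "u \<in> verts G" "parent G u = Some q" for u q
        using that mono bij_betwE[OF w(1)] by blast
      with closed show ?thesis
        by (auto simp: Des_def ranI subset_iff)
    qed
    ultimately show ?thesis using w by (simp add: des_labelings_def)
  qed
  moreover have "inj_on ?F (des_labelings G L)"
  proof (rule inj_onI)
    fix w w' assume w: "w \<in> des_labelings G L" "w' \<in> des_labelings G L" and eq: "?F w = ?F w'"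
    show "w = w'"
    proof (rule extensionalityI)
      show "w \<in> extensional (verts G)" "w' \<in> extensional (verts G)"
        using w by (auto simp: des_labelings_def)
      fix u assume u: "u \<in> verts G"
      then have "f (w u) = f (w' u)" using fun_cong[OF eq, of u] by simp
      moreover have "w u \<in> L" "w' u \<in> L"
        using w u by (auto simp: des_labelings_def bij_betw_def)
      ultimately show "w u = w' u" using inj by (auto dest: inj_onD)
    qed
  qed
  ultimately show ?thesis
    using finite_des_labelings[OF assms(1,4)] by (intro card_inj_on_le) auto
qed

lemma card_des_labelings_eq:
  assumes "finite (verts G)" "ran (parent G) \<subseteq> verts G"
    and "finite L" "finite L'" "card L = card L'"
  shows "card (des_labelings G L) = card (des_labelings G L')"
  using assms by (intro antisym card_des_labelings_le) auto

section \<open>Cutting the edge above a vertex\<close>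

text \<open>
  The edge above \<open>v\<close> is the only one between the descendants of \<open>v\<close> and the other vertices: a
  parent path from \<open>u \<noteq> v\<close> to \<open>v\<close> has to start with the step from \<open>u\<close> to its parent.
\<close>

lemma parent_in_descendants_iff:
  assumes "ran (parent G) \<subseteq> verts G" "parent G u = Some q" "u \<in> verts G" "u \<noteq> v"
  shows "q \<in> descendants G v \<longleftrightarrow> u \<in> descendants G v"
proof -
  have rel: "(u, q) \<in> parent_rel G" using assms(2) by (simp add: parent_rel_def)
  have "q \<in> verts G" using assms(1,2) by (auto intro: ranI)
  moreover have "(q, v) \<in> (parent_rel G)\<^sup>*" if "(u, v) \<in> (parent_rel G)\<^sup>*"
    using that
  proof (cases rule: converse_rtranclE)
    case (step y)
    then have "y = q" using assms(2) by (simp add: parent_rel_def)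
    with step show ?thesis by simp
  qed (use assms(4) in simp)
  ultimately show ?thesis
    using assms(3) rel by (auto simp: descendants_def intro: converse_rtrancl_into_rtrancl)
qed

lemma descendants_make_ascent [simp]: "descendants (make_ascent G v) u = descendants G u"
  by (simp add: descendants_def make_ascent_def parent_rel_def)

lemma make_ascent_sel [simp]:
  "verts (make_ascent G v) = verts G"
  "parent (make_ascent G v) = parent G"
  "descs (make_ascent G v) = descs G - {v}"
  by (simp_all add: make_ascent_def)

text \<open>
  Descents are determined edge by edge, so each part sees exactly the descents of \<open>w\<close> at its own
  vertices, apart from \<open>v\<close>, whose edge is lost.
\<close>

lemma Des_subtree:
  assumes "ran (parent G) \<subseteq> verts G"
  shows "Des (subtree (make_ascent G v) v) (restrict w (descendants G v))
    = Des G w \<inter> descendants G v - {v}"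
proof -
  have "u \<in> Des (subtree (make_ascent G v) v) (restrict w (descendants G v))
      \<longleftrightarrow> u \<in> Des G w \<inter> descendants G v - {v}" for u
  proof (cases "u \<in> descendants G v \<and> u \<noteq> v")
    case True
    moreover from True have "u \<in> verts G" by (auto simp: descendants_def)
    ultimately show ?thesis
      using parent_in_descendants_iff[OF assms, of u _ v]
      by (auto simp: Des_def subtree_def)
  qed (auto simp: Des_def subtree_def)
  then show ?thesis by blast
qed

lemma Des_delete_subtree:
  assumes "ran (parent G) \<subseteq> verts G" "v \<in> verts G"
  shows "Des (delete_subtree G v) (restrict w (verts G - descendants G v))
    = Des G w - descendants G v"
proof -
  have below: "q \<in> verts G - descendants G v"
    if "u \<in> verts G - descendants G v" "parent G u = Some q" for u q
  proof -
    have "u \<noteq> v" using that(1) assms(2) by (auto simp: descendants_def)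
    moreover have "q \<in> verts G" using assms(1) ranI[of "parent G", OF that(2)] by blast
    ultimately show ?thesis
      using that(1) parent_in_descendants_iff[OF assms(1) that(2)] by simp
  qed
  show ?thesis
  proof (rule set_eqI)
    fix u
    show "u \<in> Des (delete_subtree G v) (restrict w (verts G - descendants G v))
      \<longleftrightarrow> u \<in> Des G w - descendants G v"
    proof (cases "u \<in> verts G - descendants G v \<and> parent G u \<noteq> None")
      case True
      then obtain q where q: "parent G u = Some q" by blast
      show ?thesis
        using True q below[OF conjunct1[OF True] q] by (simp add: Des_def delete_subtree_def)
    qed (auto simp: Des_def delete_subtree_def)
  qed
qed

text \<open>
  The union on the left leaves the edge above \<open>v\<close> unconstrained. On the right, \<open>v\<close> is the root of
  its part, where it cannot be a descent: this is why it has to be made an ascent there.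
\<close>

lemma bij_betw_split:
  assumes closed: "ran (parent G) \<subseteq> verts G" and sub: "descs G \<subseteq> verts G" and v: "v \<in> descs G"
  shows "bij_betw
    (\<lambda>w. (w ` descendants G v, restrict w (descendants G v), restrict w (verts G - descendants G v)))
    (des_labelings G N \<union> des_labelings (make_ascent G v) N)
    (SIGMA L:{L. L \<subseteq> N \<and> card L = card (descendants G v)}.
       des_labelings (subtree (make_ascent G v) v) L \<times> des_labelings (delete_subtree G v) (N - L))"
    (is "bij_betw ?split ?S ?P")
proof -
  let ?V = "verts G" and ?A = "descendants G v"
  let ?B = "?V - ?A"
  let ?join = "\<lambda>(L, x, y) u. if u \<in> ?A then x u else y u"
  have AV: "?A \<subseteq> ?V" by (auto simp: descendants_def)
  have vA: "v \<in> ?A" using v sub by (auto simp: descendants_def)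
  have S_iff: "w \<in> ?S \<longleftrightarrow> w \<in> extensional ?V \<and> bij_betw w ?V N \<and> Des G w - {v} = descs G - {v}" for w
  proof -
    have "Des (make_ascent G v) w = Des G w"
      by (simp add: Des_def make_ascent_def)
    then have "w \<in> ?S \<longleftrightarrow> w \<in> extensional ?V \<and> bij_betw w ?V N
        \<and> (Des G w = descs G \<or> Des G w = descs G - {v})"
      by (auto simp: des_labelings_def make_ascent_def)
    moreover have "Des G w = descs G \<or> Des G w = descs G - {v} \<longleftrightarrow> Des G w - {v} = descs G - {v}"
      using v by blast
    ultimately show ?thesis by simp
  qed
  have des_iff: "Des G w - {v} = descs G - {v} \<longleftrightarrow>
      Des (subtree (make_ascent G v) v) (restrict w ?A) = descs (subtree (make_ascent G v) v)
      \<and> Des (delete_subtree G v) (restrict w ?B) = descs (delete_subtree G v)" for w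
  proof -
    have descs: "descs (subtree (make_ascent G v) v) = descs G \<inter> ?A - {v}"
      "descs (delete_subtree G v) = descs G - ?A"
      by (auto simp: subtree_def delete_subtree_def)
    have cut: "X - {v} = Y - {v} \<longleftrightarrow> X \<inter> ?A - {v} = Y \<inter> ?A - {v} \<and> X - ?A = Y - ?A" for X Y
    proof -
      have "Z - {v} = (Z \<inter> ?A - {v}) \<union> (Z - ?A)" "Z \<inter> ?A - {v} = (Z - {v}) \<inter> ?A"
        "Z - ?A = (Z - {v}) - ?A" for Z
        using vA by auto
      then show ?thesis by metis
    qed
    have "v \<in> verts G" using v sub by blast
    then show ?thesis
      unfolding Des_subtree[OF closed] Des_delete_subtree[OF closed \<open>v \<in> verts G\<close>] descs
      by (intro cut)
  qed
  have verts: "verts (subtree (make_ascent G v) v) = ?A" "verts (delete_subtree G v) = ?B"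
    by (simp_all add: subtree_def delete_subtree_def)
  show ?thesis
  proof (rule bij_betw_byWitness[where f' = ?join])
    show "\<forall>w\<in>?S. ?join (?split w) = w"
    proof
      fix w assume "w \<in> ?S"
      then have "w \<in> extensional ?V" unfolding S_iff by blast
      then show "?join (?split w) = w"
        using AV by (auto simp: fun_eq_iff extensional_def)
    qed
    show join_P: "\<forall>t\<in>?P. ?split (?join t) = t"
    proof
      fix t assume "t \<in> ?P"
      then obtain L x y where t: "t = (L, x, y)" "x \<in> extensional ?A" "bij_betw x ?A L"
        "y \<in> extensional ?B"
        by (auto simp: des_labelings_def verts)
      then show "?split (?join t) = t"
        by (auto simp: fun_eq_iff extensional_def bij_betw_def)
    qed
    show "?split ` ?S \<subseteq> ?P"
    proof
      fix t assume "t \<in> ?split ` ?S"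
      then obtain w where t: "t = ?split w" and "w \<in> ?S" by blast
      then have w: "bij_betw w ?V N" "Des G w - {v} = descs G - {v}"
        unfolding S_iff by blast+
      then have inj: "inj_on w ?V" and img: "w ` ?V = N" by (auto simp: bij_betw_def)
      have "bij_betw w ?A (w ` ?A)" using inj AV by (auto simp: bij_betw_def inj_on_subset)
      moreover have "w ` ?B = N - w ` ?A" using inj img AV by (simp add: inj_on_image_set_diff)
      moreover have "bij_betw w ?B (w ` ?B)" using inj by (auto simp: bij_betw_def inj_on_subset)
      moreover have "card (w ` ?A) = card ?A" using inj AV by (meson card_image inj_on_subset)
      ultimately show "t \<in> ?P"
        using w(2) des_iff[of w] img AV unfolding t
        by (auto simp: des_labelings_def verts bij_betw_restrict_eq)
    qed
    show "?join ` ?P \<subseteq> ?S"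
    proof
      fix w assume "w \<in> ?join ` ?P"
      then obtain t where tP: "t \<in> ?P" and w: "w = ?join t" by blast
      then obtain L x y where t: "t = (L, x, y)" "L \<subseteq> N" "x \<in> des_labelings (subtree (make_ascent G v) v) L"
        "y \<in> des_labelings (delete_subtree G v) (N - L)" by auto
      have "?split w = t" using join_P tP w by blast
      then have res: "restrict w ?A = x" "restrict w ?B = y" using t by auto
      have "bij_betw (restrict w ?A) ?A L" "bij_betw (restrict w ?B) ?B (N - L)"
        unfolding res using t(3,4) by (auto simp: des_labelings_def verts)
      then have "bij_betw w ?A L" "bij_betw w ?B (N - L)" by simp_all
      from bij_betw_combine[OF this] have "bij_betw w ?V N"
        using AV t(2) by (simp add: Un_absorb1 Un_Diff_cancel)
      moreover have "w \<in> extensional ?V"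
        using t(3,4) AV by (auto simp: des_labelings_def verts w t(1) extensional_def)
      moreover have "Des G w - {v} = descs G - {v}"
        unfolding des_iff res using t(3,4) by (auto simp: des_labelings_def)
      ultimately show "w \<in> ?S" unfolding S_iff by blast
    qed
  qed
qed

lemma ran_parent_subtree:
  assumes "ran (parent G) \<subseteq> verts G"
  shows "ran (parent (subtree G v)) \<subseteq> verts (subtree G v)"
proof
  fix q assume "q \<in> ran (parent (subtree G v))"
  then obtain u where "parent G u = Some q" "u \<in> descendants G v" "u \<noteq> v"
    by (auto simp: ran_def subtree_def restrict_map_def split: if_splits)
  then show "q \<in> verts (subtree G v)"
    using parent_in_descendants_iff[OF assms, of u q v] by (auto simp: subtree_def descendants_def)
qed

lemma ran_parent_delete_subtree:
  assumes "ran (parent G) \<subseteq> verts G" "v \<in> verts G"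
  shows "ran (parent (delete_subtree G v)) \<subseteq> verts (delete_subtree G v)"
proof
  fix q assume "q \<in> ran (parent (delete_subtree G v))"
  then obtain u where u: "parent G u = Some q" "u \<in> verts G" "u \<notin> descendants G v"
    by (auto simp: ran_def delete_subtree_def restrict_map_def split: if_splits)
  then have "u \<noteq> v" using assms(2) by (auto simp: descendants_def)
  then show "q \<in> verts (delete_subtree G v)"
    using u assms(1) parent_in_descendants_iff[OF assms(1), of u q v]
    by (auto simp: delete_subtree_def intro: ranI)
qed

text \<open>
  In the split, each of the \<open>m choose h\<close> label sets for the lower part contributes the same
  product, since only the number of labels matters to each part.
\<close>

lemma card_des_labelings_cut:
  assumes closed: "ran (parent G) \<subseteq> verts G" and fin: "finite (verts G)"
    and sub: "descs G \<subseteq> verts G" and v: "v \<in> descs G"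
  defines "h \<equiv> card (descendants G v)" and "m \<equiv> card (verts G)"
  shows "card (des_labelings G {1..m}) + card (des_labelings (make_ascent G v) {1..m})
    = (m choose h) * card (des_labelings (subtree (make_ascent G v) v) {1..h})
        * card (des_labelings (delete_subtree G v) {1..m - h})"
proof -
  let ?U = "subtree (make_ascent G v) v" and ?W = "delete_subtree G v"
  have AV: "descendants G v \<subseteq> verts G" by (auto simp: descendants_def)
  have finA: "finite (descendants G v)" using AV fin finite_subset by blast
  have asc: "ran (parent (make_ascent G v)) \<subseteq> verts (make_ascent G v)"
    using closed by (simp add: make_ascent_def)
  have U: "finite (verts ?U)" "ran (parent ?U) \<subseteq> verts ?U"
    using finA ran_parent_subtree[OF asc] by (simp_all add: subtree_def)
  have W: "finite (verts ?W)" "ran (parent ?W) \<subseteq> verts ?W"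
    using fin ran_parent_delete_subtree[OF closed, of v] v sub by (auto simp: delete_subtree_def)
  let ?Ls = "{L. L \<subseteq> {1..m} \<and> card L = h}"
  have finLs: "finite ?Ls" by simp
  have "des_labelings G {1..m} \<inter> des_labelings (make_ascent G v) {1..m} = {}"
    using v by (auto simp: des_labelings_def make_ascent_def Des_def)
  moreover have "finite (des_labelings G {1..m})" "finite (des_labelings (make_ascent G v) {1..m})"
    using fin by (auto intro!: finite_des_labelings simp: make_ascent_def)
  ultimately have "card (des_labelings G {1..m}) + card (des_labelings (make_ascent G v) {1..m})
      = card (des_labelings G {1..m} \<union> des_labelings (make_ascent G v) {1..m})"
    by (simp add: card_Un_disjoint)
  also have "\<dots> = card (SIGMA L:?Ls. des_labelings ?U L \<times> des_labelings ?W ({1..m} - L))"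
    using bij_betw_same_card[OF bij_betw_split[OF closed sub v]] unfolding h_def by blast
  also have "\<dots> = (\<Sum>L\<in>?Ls. card (des_labelings ?U L \<times> des_labelings ?W ({1..m} - L)))"
    using finLs U W by (intro card_SigmaI ballI finite_cartesian_product finite_des_labelings)
      (auto intro: finite_subset)
  also have "\<dots> = (\<Sum>L\<in>?Ls. card (des_labelings ?U {1..h}) * card (des_labelings ?W {1..m - h}))"
  proof (rule sum.cong[OF refl])
    fix L assume L: "L \<in> ?Ls"
    then have finL: "finite L" by (auto intro: finite_subset)
    have "card ({1..m} - L) = m - h" using L finL by (simp add: card_Diff_subset)
    then show "card (des_labelings ?U L \<times> des_labelings ?W ({1..m} - L))
        = card (des_labelings ?U {1..h}) * card (des_labelings ?W {1..m - h})"
      using L finL card_des_labelings_eq[OF U, of L "{1..h}"]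
        card_des_labelings_eq[OF W, of "{1..m} - L" "{1..m - h}"]
      by (simp add: card_cartesian_product)
  qed
  also have "\<dots> = (m choose h) * card (des_labelings ?U {1..h}) * card (des_labelings ?W {1..m - h})"
    by (simp add: n_subsets)
  finally show ?thesis .
qed

section \<open>Adding the chain\<close>

lemma card_verts_chain_ext:
  assumes "finite (verts T)" "card (verts T) \<le> n"
  shows "card (verts (chain_ext T n)) = n"
proof -
  have "card (Inl ` verts T \<union> Inr ` {..<n - card (verts T)} :: ('a + nat) set)
      = card (verts T) + (n - card (verts T))"
    using assms(1) by (subst card_Un_disjoint) (auto simp: card_image)
  then show ?thesis using assms(2) by (simp add: chain_ext_def)
qed

lemma D_set_eq_des_labelings:
  assumes "finite (verts T)" "card (verts T) \<le> n"
  shows "D_set T n = des_labelings (chain_ext T n) {1..n}"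
proof -
  have "descs (chain_ext T n) = Inl ` descs T" by (simp add: chain_ext_def)
  then show ?thesis
    unfolding D_set_def labelings_def des_labelings_def card_verts_chain_ext[OF assms] by auto
qed

lemma ran_parent_chain_ext:
  assumes "ran (parent T) \<subseteq> verts T"
  shows "ran (parent (chain_ext T n)) \<subseteq> verts (chain_ext T n)"
proof
  fix y assume "y \<in> ran (parent (chain_ext T n))"
  then obtain x where x: "parent (chain_ext T n) x = Some y" by (auto simp: ran_def)
  have T: "q \<in> verts T" if "parent T u = Some q" for u q
    using assms that by (auto intro: ranI)
  show "y \<in> verts (chain_ext T n)"
    using x T by (cases x) (auto simp: chain_ext_def split: option.splits if_splits)
qed

lemma make_ascent_chain_ext: "make_ascent (chain_ext T n) (Inl v) = chain_ext (make_ascent T v) n"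
  by (auto simp: make_ascent_def chain_ext_def fun_eq_iff split: sum.splits option.splits)

text \<open>The chain lies above the root, so parent paths never return from it to an old vertex.\<close>

lemma descendants_chain_ext:
  "descendants (chain_ext T n) (Inl v) = Inl ` descendants T v"
proof -
  have down: "\<exists>u. x = Inl u \<and> (u, v) \<in> (parent_rel T)\<^sup>*"
    if "(x, Inl v) \<in> (parent_rel (chain_ext T n))\<^sup>*" for x
    using that
  proof (induction rule: converse_rtrancl_induct)
    case (step x y)
    then obtain u where u: "y = Inl u" "(u, v) \<in> (parent_rel T)\<^sup>*" by blast
    with step(1) obtain u' where "x = Inl u'" "parent T u' = Some u"
      by (auto simp: parent_rel_def chain_ext_def split: sum.splits option.splits if_splits)
    with u show ?case by (auto simp: parent_rel_def intro: converse_rtrancl_into_rtrancl)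
  qed simp
  have up: "(Inl u, Inl v) \<in> (parent_rel (chain_ext T n))\<^sup>*" if "(u, v) \<in> (parent_rel T)\<^sup>*" for u
    using that
  proof (induction rule: converse_rtrancl_induct)
    case (step x y)
    then have "(Inl x, Inl y) \<in> parent_rel (chain_ext T n)"
      by (simp add: parent_rel_def chain_ext_def)
    with step show ?case by (blast intro: converse_rtrancl_into_rtrancl)
  qed simp
  show ?thesis
    using down up by (fastforce simp: descendants_def chain_ext_def)
qed

text \<open>
  The extension to \<open>hook T v\<close> vertices adds nothing; it only embeds the subtree into the sum type.
\<close>

lemma subtree_chain_ext:
  "subtree (chain_ext T n) (Inl v) = chain_ext (subtree T v) (hook T v)"
proof -
  have "u = v" if "u \<in> descendants T v" "parent T u = None" for u
    using that by (auto simp: descendants_def parent_rel_def elim: converse_rtranclE)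
  then show ?thesis
    unfolding subtree_def[of "chain_ext T n"] descendants_chain_ext
    by (auto simp: chain_ext_def hook_def subtree_def restrict_map_def fun_eq_iff
      split: sum.splits option.splits)
qed

text \<open>
  Deleting the subtree lowers both the size of the tree and the target size by \<open>hook T v\<close>, so the
  chain keeps its length. This includes the case where \<open>v\<close> is the root and only the chain is left.
\<close>

lemma delete_subtree_chain_ext:
  assumes "finite (verts T)" "card (verts T) \<le> n"
  shows "delete_subtree (chain_ext T n) (Inl v) = chain_ext (delete_subtree T v) (n - hook T v)"
proof -
  have AV: "descendants T v \<subseteq> verts T" by (auto simp: descendants_def)
  have h: "hook T v = card (descendants T v)" by (simp add: hook_def subtree_def)
  have "card (verts T - descendants T v) = card (verts T) - hook T v"
    using card_Diff_subset[OF finite_subset[OF AV assms(1)] AV] by (simp add: h)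
  moreover have "hook T v \<le> card (verts T)" using assms(1) AV by (simp add: h card_mono)
  ultimately have "n - hook T v - card (verts T - descendants T v) = n - card (verts T)"
    and "card (verts T - descendants T v) < n - hook T v \<longleftrightarrow> card (verts T) < n"
    using assms(2) by auto
  then show ?thesis
    unfolding delete_subtree_def[of "chain_ext T n"] descendants_chain_ext
    by (auto simp: chain_ext_def delete_subtree_def restrict_map_def fun_eq_iff
      split: sum.splits option.splits)
qed

text \<open>
  Without descents, labels strictly increase up the chain. As they are the numbers from \<open>1\<close> to
  \<open>k\<close>, the label of the \<open>i\<close>-th vertex is forced.
\<close>

lemma card_D_set_empty:
  assumes "verts T = {}" "descs T = {}"
  shows "card (D_set T k) = 1"
proof -
  have verts: "verts (chain_ext T k) = Inr ` {..<k}" using assms by (simp add: chain_ext_def)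
  have D: "w \<in> D_set T k \<longleftrightarrow> w \<in> extensional (Inr ` {..<k}) \<and> bij_betw w (Inr ` {..<k}) {1..k}
      \<and> (\<forall>i. Suc i < k \<longrightarrow> w (Inr i) \<le> w (Inr (Suc i)))" for w
  proof -
    have "parent (chain_ext T k) (Inr i) = (if Suc i < k then Some (Inr (Suc i)) else None)" for i
      using assms by (simp add: chain_ext_def)
    then have "Des (chain_ext T k) w = Inr ` {i. Suc i < k \<and> w (Inr (Suc i)) < w (Inr i)}"
      by (auto simp: Des_def verts split: if_splits)
    then have "Des (chain_ext T k) w = {} \<longleftrightarrow> (\<forall>i. Suc i < k \<longrightarrow> w (Inr i) \<le> w (Inr (Suc i)))"
      by (auto simp flip: not_less)
    then show ?thesis
      using assms by (auto simp: D_set_def labelings_def verts card_image)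
  qed
  let ?w0 = "restrict (case_sum undefined Suc) (Inr ` {..<k}) :: 'a + nat \<Rightarrow> nat"
  have "?w0 \<in> D_set T k"
    unfolding D
    by (auto simp: bij_betw_def inj_on_def image_image lessThan_atLeast0 image_Suc_atLeastLessThan
      atLeastLessThanSuc_atLeastAtMost)
  moreover have "w = ?w0" if "w \<in> D_set T k" for w
  proof (rule extensionalityI)
    have w: "w \<in> extensional (Inr ` {..<k})" "inj_on w (Inr ` {..<k})" "w ` Inr ` {..<k} = {1..k}"
      "\<And>i. Suc i < k \<Longrightarrow> w (Inr i) \<le> w (Inr (Suc i))"
      using that by (auto simp: D bij_betw_def)
    show "w \<in> extensional (Inr ` {..<k})" "?w0 \<in> extensional (Inr ` {..<k})" using w by auto
    fix x :: "'a + nat" assume "x \<in> Inr ` {..<k}"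
    then obtain i where x: "x = Inr i" "i < k" by auto
    have step: "w (Inr i) < w (Inr (Suc i))" if "Suc i < k" for i
    proof -
      have "w (Inr i) \<noteq> w (Inr (Suc i))"
        using inj_onD[OF w(2), of "Inr i" "Inr (Suc i)"] that by auto
      then show ?thesis using w(4)[OF that] by simp
    qed
    \<comment> \<open>Counting up from the bottom, whose label is at least \<open>1\<close>, gives the lower bound.\<close>
    have low: "Suc j \<le> w (Inr j)" if "j < k" for j
      using that
    proof (induction j)
      case 0
      then have "w (Inr 0) \<in> {1..k}" unfolding w(3)[symmetric] by simp
      then show ?case by simp
    next
      case (Suc j)
      then show ?case using step[of j] by simp
    qed
    \<comment> \<open>Counting up to the top of the chain, whose label is at most \<open>k\<close>, bounds the label of
      vertex \<open>i\<close> from above by \<open>i + 1\<close>.\<close>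
    have "w (Inr i) + j \<le> w (Inr (i + j))" if "i + j < k" for j
      using that
    proof (induction j)
      case (Suc j)
      then show ?case using step[of "i + j"] by simp
    qed simp
    from this[of "k - Suc i"] have "w (Inr i) + (k - Suc i) \<le> w (Inr (k - 1))" using x by simp
    moreover have "w (Inr (k - 1)) \<in> {1..k}" unfolding w(3)[symmetric] using x by simp
    ultimately have "w (Inr i) = Suc i" using low[OF x(2)] x(2) by auto
    then show "w x = ?w0 x" using x by simp
  qed
  ultimately have "D_set T k = {?w0}" by blast
  then show ?thesis by simp
qed

lemma d_eq_card_D_set:
  assumes "descs T \<subseteq> verts T"
  shows "d T k = card (D_set T k)"
  using assms card_D_set_empty[of T k] by (auto simp: d_def)

section \<open>The recurrence\<close>

theorem proposition2p1:
  fixes T :: "'a dtree" and v :: 'a and n :: nat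
  assumes "rooted_tree T"
    and "card (verts T) \<le> n"
    and "v \<in> descs T"
  shows "int (d T n) =
    int (n choose hook T v) * int (d (subtree (make_ascent T v) v) (hook T v))
      * int (d (delete_subtree T v) (n - hook T v))
    - int (d (make_ascent T v) n)"
proof -
  let ?A = "make_ascent T v" and ?G = "chain_ext T n"
  let ?U = "subtree ?A v" and ?W = "delete_subtree T v"
  have T: "finite (verts T)" "descs T \<subseteq> verts T" "ran (parent T) \<subseteq> verts T"
    using assms(1) by (auto simp: rooted_tree_def)
  have DV: "descendants T v \<subseteq> verts T" by (auto simp: descendants_def)
  have h: "hook T v = card (descendants T v)" "hook ?A v = hook T v"
    by (simp_all add: hook_def subtree_def)
  have "card (verts ?W) = card (verts T) - hook T v"
    using card_Diff_subset[OF finite_subset[OF DV T(1)] DV] by (simp add: h delete_subtree_def)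
  then have W: "card (verts ?W) \<le> n - hook T v" "finite (verts ?W)"
    using assms(2) T(1) by (auto simp: delete_subtree_def)
  have G: "finite (verts ?G)" "descs ?G \<subseteq> verts ?G" "Inl v \<in> descs ?G"
    using T assms(3) by (auto simp: chain_ext_def)
  have dT: "d T n = card (des_labelings ?G {1..n})"
    using T assms(2) by (simp add: d_eq_card_D_set D_set_eq_des_labelings)
  have dA: "d ?A n = card (des_labelings (make_ascent ?G (Inl v)) {1..n})"
    using d_eq_card_D_set[of ?A n] D_set_eq_des_labelings[of ?A n] T(1,2) assms(2)
    by (simp add: make_ascent_chain_ext subset_iff)
  have commute: "subtree (make_ascent ?G (Inl v)) (Inl v) = chain_ext ?U (hook T v)"
    using subtree_chain_ext[of ?A n v] by (simp add: make_ascent_chain_ext h)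
  have dU: "d ?U (hook T v)
      = card (des_labelings (subtree (make_ascent ?G (Inl v)) (Inl v)) {1..hook T v})"
  proof -
    have "descs ?U \<subseteq> verts ?U" "finite (verts ?U)" "card (verts ?U) = hook T v"
      using finite_subset[OF DV T(1)] by (auto simp: subtree_def h)
    then show ?thesis by (simp add: commute d_eq_card_D_set D_set_eq_des_labelings)
  qed
  have dW: "d ?W (n - hook T v)
      = card (des_labelings (delete_subtree ?G (Inl v)) {1..n - hook T v})"
  proof -
    have "descs ?W \<subseteq> verts ?W" using T(2) by (auto simp: delete_subtree_def)
    then show ?thesis
      using W T(1) assms(2)
      by (simp add: d_eq_card_D_set D_set_eq_des_labelings delete_subtree_chain_ext)
  qed
  have "d T n + d ?A n = (n choose hook T v) * d ?U (hook T v) * d ?W (n - hook T v)"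
    using card_des_labelings_cut[OF ran_parent_chain_ext[OF T(3)] G]
      card_verts_chain_ext[OF T(1) assms(2)]
    unfolding dT dA dU dW by (simp add: descendants_chain_ext card_image h(1))
  then have "int (d T n) + int (d ?A n)
      = int (n choose hook T v) * int (d ?U (hook T v)) * int (d ?W (n - hook T v))"
    by (metis of_nat_add of_nat_mult)
  then show ?thesis by simp
qed

end
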